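(* Let $X$ be a hereditary class of graphs. If the number of prime $n$-vertex labelled graphs in $X$ is $2^{O(n\log n)}$, then the number of all $n$-vertex labelled graphs in $X$ is $2^{O(n\log n)}$.
   Context: Graphs are finite, simple and undirected. A labelled $n$-vertex graph is a graph with vertex set $\{1,\ldots,n\}$. A class of graphs is a set of graphs closed under isomorphism; it is hereditary if it is closed under taking induced subgraphs. Given a graph $G$ and $U\subset V(G)$, a vertex $x$ outside $U$ distinguishes $U$ if it has both a neighbour and a non-neighbour in $U$. A (nonempty) proper subset of $V(G)$ is a module if no vertex outside it distinguishes it. A module is trivial if it consists of a single vertex. A graph is prime if every module of it is trivial. *)

theory Defs
  imports Complex_Main "HOL-Library.Landau_Symbols" "Graph_Theory.Graph_Theory"
begin

text \<open>
  A finite simple undirected graph is a \<^locale>\<open>pair_graph\<close>: \<^term>\<open>parcs G\<close> is an irreflexive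
  symmetric relation on the finite set \<^term>\<open>pverts G\<close>.  A class of graphs is represented by its
  members with vertices in \<^typ>\<open>nat\<close>; every finite graph is isomorphic to one of these, so a class
  closed under isomorphism is determined by them.
\<close>

definition graph_class :: "nat pair_pre_digraph set \<Rightarrow> bool" where
  "graph_class X \<longleftrightarrow>
     (\<forall>G\<in>X. pair_graph G) \<and>
     (\<forall>G\<in>X. \<forall>H. digraph_iso (with_proj G) (with_proj H) \<longrightarrow> H \<in> X)"

definition hereditary :: "nat pair_pre_digraph set \<Rightarrow> bool" where
  "hereditary X \<longleftrightarrow>
     graph_class X \<and>
     (\<forall>G\<in>X. \<forall>H. induced_subgraph (with_proj H) (with_proj G) \<longrightarrow> H \<in> X)"

definition distinguishes :: "'a pair_pre_digraph \<Rightarrow> 'a \<Rightarrow> 'a set \<Rightarrow> bool" where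
  "distinguishes G x U \<longleftrightarrow>
     x \<in> pverts G - U \<and> (\<exists>u\<in>U. (x, u) \<in> parcs G) \<and> (\<exists>u\<in>U. (x, u) \<notin> parcs G)"

definition is_module :: "'a pair_pre_digraph \<Rightarrow> 'a set \<Rightarrow> bool" where
  "is_module G U \<longleftrightarrow> U \<noteq> {} \<and> U \<subset> pverts G \<and> \<not> (\<exists>x. distinguishes G x U)"

definition trivial_module :: "'a set \<Rightarrow> bool" where
  "trivial_module U \<longleftrightarrow> (\<exists>v. U = {v})"

definition prime_graph :: "'a pair_pre_digraph \<Rightarrow> bool" where
  "prime_graph G \<longleftrightarrow> (\<forall>U. is_module G U \<longrightarrow> trivial_module U)"

definition labelled_graphs :: "nat pair_pre_digraph set \<Rightarrow> nat \<Rightarrow> nat pair_pre_digraph set" where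
  "labelled_graphs X n = {G \<in> X. pverts G = {1..n}}"

text \<open>
  As usual, ``\<open>a n\<close> is \<open>2\<^sup>O\<^sup>(\<^sup>g\<^sup>)\<close>'' is an upper bound only; in particular \<open>a n = 0\<close> is allowed.
  Membership in \<open>O\<close> does not constrain \<open>f\<close> at any finite set of arguments, so neither the
  universal quantifier over \<open>n\<close> nor the zero of \<open>n log n\<close> at \<open>n = 1\<close> matters.
\<close>

definition two_pow_bigo :: "(nat \<Rightarrow> nat) \<Rightarrow> (nat \<Rightarrow> real) \<Rightarrow> bool" where
  "two_pow_bigo a g \<longleftrightarrow> (\<exists>f \<in> O(g). \<forall>n. real (a n) \<le> 2 powr f n)"

lemma digraph_iso_with_proj_iff:
  assumes "pair_wf_digraph G"
  shows "digraph_iso (with_proj G) (with_proj H) \<longleftrightarrow>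
    (\<exists>f. inj_on f (pverts G) \<and> pverts H = f ` pverts G \<and> parcs H = map_prod f f ` parcs G)"
proof
  assume "digraph_iso (with_proj G) (with_proj H)"
  then obtain h where h: "pre_digraph.digraph_isomorphism (with_proj G) h"
    and eq: "with_proj H = app_iso h (with_proj G)"
    unfolding digraph_iso_def by blast
  have t: "iso_tail h = fst" and hd: "iso_head h = snd"
    and v: "pverts H = iso_verts h ` pverts G" and a: "parcs H = iso_arcs h ` parcs G"
    using eq unfolding with_proj_def app_iso_def by auto
  have i: "inj_on (iso_verts h) (pverts G)"
    and e: "\<forall>x\<in>parcs G. iso_arcs h x = map_prod (iso_verts h) (iso_verts h) x"
    using h unfolding pre_digraph.digraph_isomorphism_def
    by (auto simp: t hd prod_eq_iff)
  show "\<exists>f. inj_on f (pverts G) \<and> pverts H = f ` pverts G \<and> parcs H = map_prod f f ` parcs G"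
    using i v a e by (intro exI[of _ "iso_verts h"]) (auto simp: image_def)
next
  assume "\<exists>f. inj_on f (pverts G) \<and> pverts H = f ` pverts G \<and> parcs H = map_prod f f ` parcs G"
  then obtain f where f: "inj_on f (pverts G)" "pverts H = f ` pverts G"
    "parcs H = map_prod f f ` parcs G" by blast
  let ?h = "\<lparr> iso_verts = f, iso_arcs = map_prod f f, iso_head = snd, iso_tail = fst \<rparr>"
  have "parcs G \<subseteq> pverts G \<times> pverts G"
    using assms by (auto dest: pair_wf_digraph.in_arcsD1 pair_wf_digraph.in_arcsD2)
  then have "inj_on (map_prod f f) (parcs G)"
    using map_prod_inj_on[OF f(1) f(1)] inj_on_subset by blast
  then have "pre_digraph.digraph_isomorphism (with_proj G) ?h"
    using f(1) assms by (auto simp: pre_digraph.digraph_isomorphism_def wf_digraph_wp_iff)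
  moreover have "with_proj H = app_iso ?h (with_proj G)"
    using f by (simp add: with_proj_def app_iso_def)
  ultimately show "digraph_iso (with_proj G) (with_proj H)"
    unfolding digraph_iso_def by blast
qed

lemma finite_labelled_graphs:
  assumes "graph_class X"
  shows "finite (labelled_graphs X n)"
proof -
  have "labelled_graphs X n \<subseteq>
    (\<lambda>E. \<lparr> pverts = {1..n}, parcs = E \<rparr>) ` Pow ({1..n} \<times> {1..n})"
  proof
    fix G assume G: "G \<in> labelled_graphs X n"
    then have "pair_graph G" and V: "pverts G = {1..n}"
      using assms by (auto simp: labelled_graphs_def graph_class_def)
    then have "pair_wf_digraph G"
      by (simp add: pair_graph_def pair_digraph_def pair_fin_digraph_def)
    then have "parcs G \<subseteq> {1..n} \<times> {1..n}"
      using V by (auto dest: pair_wf_digraph.in_arcsD1 pair_wf_digraph.in_arcsD2)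
    moreover have "G = \<lparr> pverts = {1..n}, parcs = parcs G \<rparr>"
      using V by simp
    ultimately show "G \<in> (\<lambda>E. \<lparr> pverts = {1..n}, parcs = E \<rparr>) ` Pow ({1..n} \<times> {1..n})"
      by blast
  qed
  then show ?thesis by (rule finite_subset) simp
qed

end

theory Submission
  imports Defs
begin

text \<open>
  A graph that is not prime has a module \<open>U\<close> with at least two vertices.  Every vertex outside \<open>U\<close>
  sees all of \<open>U\<close> in the same way, so the graph is determined by \<open>U\<close> together with two smaller
  induced subgraphs: the one on \<open>U\<close>, and the one on the complement of \<open>U\<close> plus a representative
  \<open>r \<in> U\<close> (\<open>graph_eq_if_same_module_parts\<close>).  Both lie in the hereditary class.  Hence, if \<open>f n\<close>
  and \<open>p n\<close> count the labelled graphs and the prime labelled graphs of the class,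
  \<open>f n \<le> p n + (\<Sum>k=2..<n. (n choose k) * f k * f (n - k + 1))\<close>.  A graph may
  arise from several modules, and this overcounting is harmless for an upper bound.

  The two parts have \<open>k\<close> and \<open>n - k + 1\<close> vertices, so ``number of vertices minus one'' is additive
  under splitting.  This suggests the majorant \<open>(fact (n - 1)) ^ D * C ^ (n - 1)\<close>: inserting it
  on the right, with \<open>m = n - 1\<close> and \<open>a = k - 1\<close>, gives the same power of \<open>C\<close> as on the left, while
  the factorials \<open>(fact a * fact (m - a)) ^ D\<close> are smaller than \<open>(fact m) ^ D\<close> by the factor
  \<open>(m choose a) ^ D\<close>.  As \<open>m choose a \<ge> m\<close> for \<open>0 < a < m\<close>, the choice \<open>D \<ge> 3\<close> beats
  the binomial coefficient and the number of summands with a factor two to spare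
  (\<open>twice_sum_splits_le\<close>), and the other half of the majorant absorbs the prime graphs
  (\<open>recurrence_bound\<close>).  Up to an exponential factor, \<open>fact (n - 1)\<close> and
  \<open>n ^ n = 2 powr (n * log 2 n)\<close> agree, so bounds with an exponent of order \<open>n log n\<close> can be
  turned into such majorants and back.
\<close>

section \<open>Restricting and relabelling graphs\<close>

definition induced_pair_graph :: "'a pair_pre_digraph \<Rightarrow> 'a set \<Rightarrow> 'a pair_pre_digraph" where
  "induced_pair_graph G S = \<lparr> pverts = S, parcs = parcs G \<inter> S \<times> S \<rparr>"

definition graphs_on :: "nat pair_pre_digraph set \<Rightarrow> nat set \<Rightarrow> nat pair_pre_digraph set" where
  "graphs_on X S = {G \<in> X. pverts G = S}"

lemma labelled_graphs_eq_graphs_on: "labelled_graphs X n = graphs_on X {1..n}"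
  by (simp add: labelled_graphs_def graphs_on_def)

lemma pair_graph_wf: "pair_graph G \<Longrightarrow> pair_wf_digraph G"
  by (simp add: pair_graph_def pair_digraph_def pair_fin_digraph_def)

lemma parcs_subset_pverts:
  assumes "pair_graph G"
  shows "parcs G \<subseteq> pverts G \<times> pverts G"
proof -
  interpret pair_graph G by fact
  show ?thesis using in_arcsD1 in_arcsD2 by auto
qed

lemma pair_graph_sym:
  assumes "pair_graph G"
  shows "(x, y) \<in> parcs G \<longleftrightarrow> (y, x) \<in> parcs G"
proof -
  interpret pair_graph G by fact
  show ?thesis using arcs_symmetric by blast
qed

lemma hereditary_pair_graph: "hereditary X \<Longrightarrow> G \<in> X \<Longrightarrow> pair_graph G"
  unfolding hereditary_def graph_class_def by blast

lemma induced_pair_graph_in_graphs_on: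
  assumes "hereditary X" "G \<in> X" "S \<subseteq> pverts G"
  shows "induced_pair_graph G S \<in> graphs_on X S"
proof -
  have wf: "pair_wf_digraph G"
    using assms hereditary_pair_graph pair_graph_wf by blast
  have wfH: "pair_wf_digraph (induced_pair_graph G S)"
    by unfold_locales (auto simp: induced_pair_graph_def)
  have "induced_subgraph (with_proj (induced_pair_graph G S)) (with_proj G)"
    using assms(3) wf wfH
    unfolding induced_subgraph_def subgraph_def compatible_def wf_digraph_wp_iff
    by (auto simp: induced_pair_graph_def with_proj_def)
  then have "induced_pair_graph G S \<in> X"
    using assms(1,2) unfolding hereditary_def by blast
  then show ?thesis by (simp add: graphs_on_def induced_pair_graph_def)
qed

text \<open>
  A class is closed under isomorphism, so the number of its graphs on a vertex set depends only on
  the size of that set.  Transporting graphs along a bijection onto \<open>{1..card S}\<close> is injective, which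
  suffices for upper bounds.
\<close>

lemma graphs_on_inject_labelled_graphs:
  assumes "hereditary X" "finite S"
  obtains \<phi> where "inj_on \<phi> (graphs_on X S)"
    and "\<phi> ` graphs_on X S \<subseteq> labelled_graphs X (card S)"
proof -
  obtain f where f: "bij_betw f S {1..card S}"
    using finite_same_card_bij[OF assms(2), of "{1..card S}"] by auto
  define \<phi> where "\<phi> = (\<lambda>G::nat pair_pre_digraph.
    \<lparr> pverts = f ` pverts G, parcs = map_prod f f ` parcs G \<rparr>)"
  have inj: "inj_on f S" and im: "f ` S = {1..card S}" using f by (auto simp: bij_betw_def)
  have "inj_on \<phi> (graphs_on X S)"
  proof (rule inj_onI)
    fix G H assume G: "G \<in> graphs_on X S" and H: "H \<in> graphs_on X S" and eq: "\<phi> G = \<phi> H"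
    have "parcs G \<subseteq> S \<times> S" "parcs H \<subseteq> S \<times> S"
      using G H assms(1) parcs_subset_pverts hereditary_pair_graph
      unfolding graphs_on_def by blast+
    moreover have "map_prod f f ` parcs G = map_prod f f ` parcs H"
      using eq by (simp add: \<phi>_def)
    ultimately have "parcs G = parcs H"
      using inj_on_image_eq_iff[OF map_prod_inj_on[OF inj inj]] by blast
    then show "G = H" using G H by (simp add: graphs_on_def)
  qed
  moreover have "\<phi> ` graphs_on X S \<subseteq> labelled_graphs X (card S)"
  proof
    fix H assume "H \<in> \<phi> ` graphs_on X S"
    then obtain G where G: "G \<in> X" "pverts G = S" and H: "H = \<phi> G"
      by (auto simp: graphs_on_def)
    have "pair_wf_digraph G" using assms(1) G(1) hereditary_pair_graph pair_graph_wf by blast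
    then have "digraph_iso (with_proj G) (with_proj H)"
      using inj G(2) by (subst digraph_iso_with_proj_iff) (auto simp: H \<phi>_def)
    then have "H \<in> X" using assms(1) G(1) unfolding hereditary_def graph_class_def by blast
    then show "H \<in> labelled_graphs X (card S)"
      using im G(2) by (simp add: labelled_graphs_def H \<phi>_def)
  qed
  ultimately show ?thesis using that by blast
qed

lemma finite_graphs_on:
  assumes "hereditary X" "finite S"
  shows "finite (graphs_on X S)"
proof -
  obtain \<phi> where "inj_on \<phi> (graphs_on X S)" "\<phi> ` graphs_on X S \<subseteq> labelled_graphs X (card S)"
    using graphs_on_inject_labelled_graphs[OF assms] .
  moreover have "finite (labelled_graphs X (card S))"
    using assms(1) by (simp add: finite_labelled_graphs hereditary_def)
  ultimately show ?thesis by (rule inj_on_finite)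
qed

lemma card_graphs_on_le:
  assumes "hereditary X" "finite S"
  shows "card (graphs_on X S) \<le> card (labelled_graphs X (card S))"
proof -
  obtain \<phi> where "inj_on \<phi> (graphs_on X S)" "\<phi> ` graphs_on X S \<subseteq> labelled_graphs X (card S)"
    using graphs_on_inject_labelled_graphs[OF assms] .
  moreover have "finite (labelled_graphs X (card S))"
    using assms(1) by (simp add: finite_labelled_graphs hereditary_def)
  ultimately show ?thesis by (rule card_inj_on_le)
qed

section \<open>Splitting a graph along a module\<close>

text \<open>
  Edges inside \<open>U\<close> are recorded by the first part and edges outside \<open>U\<close> by the second.  For
  \<open>x \<notin> U\<close> and \<open>y \<in> U\<close>, the pair \<open>(x, y)\<close> is an edge iff \<open>(x, r)\<close> is, because \<open>x\<close> does not
  distinguish \<open>U\<close>; and \<open>(x, r)\<close> is recorded by the second part.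
\<close>

lemma graph_eq_if_same_module_parts:
  assumes G: "pair_graph G" "is_module G U" and H: "pair_graph H" "is_module H U"
    and V: "pverts G = pverts H" and r: "r \<in> U"
    and inner: "induced_pair_graph G U = induced_pair_graph H U"
    and outer: "induced_pair_graph G (insert r (pverts G - U))
      = induced_pair_graph H (insert r (pverts H - U))"
  shows "G = H"
proof -
  have inner': "(x, y) \<in> parcs G \<longleftrightarrow> (x, y) \<in> parcs H" if "x \<in> U" "y \<in> U" for x y
    using inner that unfolding induced_pair_graph_def by auto
  have outer': "(x, y) \<in> parcs G \<longleftrightarrow> (x, y) \<in> parcs H"
    if "x \<in> insert r (pverts G - U)" "y \<in> insert r (pverts G - U)" for x y
  proof -
    have "parcs G \<inter> insert r (pverts G - U) \<times> insert r (pverts G - U) =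
        parcs H \<inter> insert r (pverts G - U) \<times> insert r (pverts G - U)"
      using outer V unfolding induced_pair_graph_def by simp
    then show ?thesis using that by blast
  qed
  have rep: "(x, y) \<in> parcs K \<longleftrightarrow> (x, r) \<in> parcs K"
    if "is_module K U" "x \<in> pverts K - U" "y \<in> U" for K x y
  proof -
    have "\<not> ((\<exists>u\<in>U. (x, u) \<in> parcs K) \<and> (\<exists>u\<in>U. (x, u) \<notin> parcs K))"
      using that(1,2) unfolding is_module_def distinguishes_def by blast
    then show ?thesis using that(3) r by blast
  qed
  have cross: "(x, y) \<in> parcs G \<longleftrightarrow> (x, y) \<in> parcs H" if "x \<in> pverts G - U" "y \<in> U" for x y
  proof -
    have "(x, y) \<in> parcs G \<longleftrightarrow> (x, r) \<in> parcs G" using rep[OF G(2) that] .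
    also have "\<dots> \<longleftrightarrow> (x, r) \<in> parcs H" using outer'[of x r] that(1) by simp
    also have "\<dots> \<longleftrightarrow> (x, y) \<in> parcs H" using rep[OF H(2), of x y] that V by simp
    finally show ?thesis .
  qed
  have "(x, y) \<in> parcs G \<longleftrightarrow> (x, y) \<in> parcs H" if "x \<in> pverts G" "y \<in> pverts G" for x y
  proof (cases "x \<in> U"; cases "y \<in> U")
    assume "x \<in> U" "y \<notin> U"
    then show ?thesis
      using cross[of y x] that pair_graph_sym[OF G(1), of x y] pair_graph_sym[OF H(1), of x y]
      by simp
  qed (use inner' outer' cross that in auto)
  then have "parcs G = parcs H"
    using parcs_subset_pverts[OF G(1)] parcs_subset_pverts[OF H(1)] V by auto
  then show ?thesis using V by simp
qed

text \<open>
  The representative depends only on \<open>U\<close>, not on the graph; thus restricting to the two parts maps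
  all graphs with module \<open>U\<close> into one product of two sets of graphs, injectively by the preceding
  lemma.
\<close>

lemma card_graphs_with_module_le:
  assumes X: "hereditary X" and V: "finite V" and U: "U \<subseteq> V" "U \<noteq> {}"
  shows "card {G \<in> graphs_on X V. is_module G U} \<le>
    card (labelled_graphs X (card U)) * card (labelled_graphs X (card V - card U + 1))"
proof -
  define r where "r = (SOME r. r \<in> U)"
  have r: "r \<in> U" using U(2) unfolding r_def by (simp add: some_in_eq)
  define W where "W = insert r (V - U)"
  have fin: "finite U" "finite W" using V U finite_subset by (auto simp: W_def)
  have cW: "card W = card V - card U + 1"
    using V U r fin by (simp add: W_def card_Diff_subset)
  have fins: "finite (graphs_on X U \<times> graphs_on X W)"
    using finite_graphs_on[OF X] fin by blast
  have "card {G \<in> graphs_on X V. is_module G U} \<le> card (graphs_on X U \<times> graphs_on X W)"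
  proof (rule card_inj_on_le[OF _ _ fins])
    show "inj_on (\<lambda>G. (induced_pair_graph G U, induced_pair_graph G W))
        {G \<in> graphs_on X V. is_module G U}"
    proof (rule inj_onI)
      fix G H
      assume GH: "G \<in> {G \<in> graphs_on X V. is_module G U}"
          "H \<in> {G \<in> graphs_on X V. is_module G U}"
        and eq: "(induced_pair_graph G U, induced_pair_graph G W) =
          (induced_pair_graph H U, induced_pair_graph H W)"
      have "pair_graph G" "pair_graph H" "is_module G U" "is_module H U"
        "pverts G = V" "pverts H = V"
        using GH hereditary_pair_graph[OF X] by (auto simp: graphs_on_def)
      then show "G = H"
        using eq
        by (intro graph_eq_if_same_module_parts[OF _ _ _ _ _ r, of G H]) (simp_all add: W_def)
    qed
    show "(\<lambda>G. (induced_pair_graph G U, induced_pair_graph G W)) `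
        {G \<in> graphs_on X V. is_module G U} \<subseteq> graphs_on X U \<times> graphs_on X W"
    proof
      fix p assume "p \<in> (\<lambda>G. (induced_pair_graph G U, induced_pair_graph G W)) `
        {G \<in> graphs_on X V. is_module G U}"
      then obtain G where G: "G \<in> X" "pverts G = V"
        and p: "p = (induced_pair_graph G U, induced_pair_graph G W)"
        by (auto simp: graphs_on_def)
      have "W \<subseteq> V" using r U by (auto simp: W_def)
      then show "p \<in> graphs_on X U \<times> graphs_on X W"
        using induced_pair_graph_in_graphs_on[OF X G(1)] U(1) G(2) p by simp
    qed
  qed
  also have "\<dots> = card (graphs_on X U) * card (graphs_on X W)" by (simp add: card_cartesian_product)
  also have "\<dots> \<le> card (labelled_graphs X (card U)) * card (labelled_graphs X (card W))"
    by (intro mult_le_mono card_graphs_on_le X fin)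
  finally show ?thesis by (simp add: cW)
qed

text \<open>
  Summing over all \<open>U\<close> with \<open>2 \<le> card U < n\<close>, and grouping these by their size, bounds the graphs
  that have a nontrivial module.  A graph with several such modules is counted several times.
\<close>

lemma card_labelled_graphs_le_prime_plus_splits:
  assumes X: "hereditary X"
  shows "card (labelled_graphs X n) \<le> card {G \<in> labelled_graphs X n. prime_graph G} +
    (\<Sum>k\<in>{2..<n}. (n choose k) *
      (card (labelled_graphs X k) * card (labelled_graphs X (n - k + 1))))"
proof -
  define V where "V = {1..n}"
  have V: "finite V" "card V = n" by (auto simp: V_def)
  define M where "M = {U. U \<subseteq> V \<and> card U \<in> {2..<n}}"
  define g where "g = (\<lambda>k. card (labelled_graphs X k) * card (labelled_graphs X (n - k + 1)))"
  have fM: "finite M" using V by (simp add: M_def)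
  have cover: "labelled_graphs X n \<subseteq> {G \<in> labelled_graphs X n. prime_graph G} \<union>
      (\<Union>U\<in>M. {G \<in> graphs_on X V. is_module G U})"
  proof
    fix G assume G: "G \<in> labelled_graphs X n"
    show "G \<in> {G \<in> labelled_graphs X n. prime_graph G} \<union>
      (\<Union>U\<in>M. {G \<in> graphs_on X V. is_module G U})"
    proof (cases "prime_graph G")
      case False
      then obtain U where U: "is_module G U" "\<not> trivial_module U"
        by (auto simp: prime_graph_def)
      have ps: "U \<noteq> {}" "U \<subset> V"
        using U(1) G by (auto simp: is_module_def labelled_graphs_def V_def)
      then have "finite U" using V(1) finite_subset by blast
      have "card U < n" using psubset_card_mono[OF V(1) ps(2)] V(2) by simp
      moreover have "card U \<noteq> 0" "card U \<noteq> 1"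
        using ps(1) \<open>finite U\<close> U(2) by (auto simp: trivial_module_def card_1_singleton_iff)
      ultimately have "U \<in> M" using ps(2) by (auto simp: M_def)
      then show ?thesis using U(1) G by (auto simp: labelled_graphs_eq_graphs_on V_def)
    qed (use G in simp)
  qed
  have fins: "finite (graphs_on X V)" using finite_graphs_on[OF X V(1)] .
  then have "card (labelled_graphs X n) \<le> card ({G \<in> labelled_graphs X n. prime_graph G} \<union>
      (\<Union>U\<in>M. {G \<in> graphs_on X V. is_module G U}))"
    using fM by (intro card_mono[OF _ cover]) (auto simp: labelled_graphs_eq_graphs_on V_def)
  also have "\<dots> \<le> card {G \<in> labelled_graphs X n. prime_graph G} +
      card (\<Union>U\<in>M. {G \<in> graphs_on X V. is_module G U})"
    by (rule card_Un_le)
  also have "card (\<Union>U\<in>M. {G \<in> graphs_on X V. is_module G U}) \<le>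
      (\<Sum>U\<in>M. card {G \<in> graphs_on X V. is_module G U})"
    by (rule card_UN_le[OF fM])
  also have "\<dots> \<le> (\<Sum>U\<in>M. g (card U))"
  proof (rule sum_mono)
    fix U assume "U \<in> M"
    then have "U \<subseteq> V" "U \<noteq> {}" by (auto simp: M_def)
    then show "card {G \<in> graphs_on X V. is_module G U} \<le> g (card U)"
      using card_graphs_with_module_le[OF X V(1)] V(2) by (simp add: g_def)
  qed
  also have "\<dots> = (\<Sum>k\<in>{2..<n}. \<Sum>U\<in>{U\<in>M. card U = k}. g (card U))"
    using sum.group[OF fM, of "{2..<n}" card "\<lambda>U. g (card U)"] by (simp add: M_def image_subset_iff)
  also have "\<dots> = (\<Sum>k\<in>{2..<n}. (n choose k) * g k)"
  proof (rule sum.cong[OF refl])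
    fix k assume k: "k \<in> {2..<n}"
    have "{U\<in>M. card U = k} = {U. U \<subseteq> V \<and> card U = k}" using k by (auto simp: M_def)
    then show "(\<Sum>U\<in>{U\<in>M. card U = k}. g (card U)) = (n choose k) * g k"
      using n_subsets[OF V(1), of k] V(2) by simp
  qed
  finally show ?thesis by (simp add: g_def)
qed

section \<open>Solving the recurrence\<close>

lemma le_choose: "0 < k \<Longrightarrow> k < n \<Longrightarrow> n \<le> n choose k"
proof (induction n arbitrary: k)
  case (Suc n)
  then obtain j where k: "k = Suc j" by (cases k) auto
  show ?case
  proof (cases "k = n")
    case True
    then show ?thesis using Suc.prems by (simp add: binomial_symmetric[of n "Suc n"])
  next
    case False
    then have "n \<le> n choose k" using Suc by auto
    moreover have "0 < n choose j" using Suc.prems k by simp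
    ultimately show ?thesis unfolding k binomial_Suc_Suc by linarith
  qed
qed simp

text \<open>
  With \<open>m = a + b\<close> and \<open>c = m choose a\<close>, the identity \<open>fact m = c * (fact a * fact b)\<close> reduces the claim
  to \<open>2 * (m - 1) * (m + 1 choose a + 1) \<le> c ^ D\<close>.  Absorption gives
  \<open>(a + 1) * (m + 1 choose a + 1) = (m + 1) * c\<close>, and \<open>a + 1 \<ge> 2\<close> takes care of the factor two.
  What remains is \<open>(m - 1) * (m + 1) * c \<le> c ^ 3\<close>, which is where \<open>D \<ge> 3\<close> and \<open>c \<ge> m\<close> enter.
  The factor \<open>a + b - 1\<close> is the number of ways to split \<open>m\<close> into two positive summands, so that
  the bound can be summed over all of them.
\<close>

lemma twice_split_term_le:
  fixes a b D :: nat
  assumes ab: "0 < a" "0 < b" and D: "3 \<le> D"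
  shows "(a + b - 1) * (2 * ((a + b + 1 choose (a + 1)) * (fact a * fact b) ^ D))
    \<le> (fact (a + b) :: nat) ^ D"
proof -
  define m where "m = a + b"
  define c where "c = m choose a"
  have m: "m \<le> c" unfolding c_def by (rule le_choose) (use ab in \<open>auto simp: m_def\<close>)
  have c0: "0 < c" using m ab by (simp add: m_def)
  have fact_m: "fact m = c * (fact a * fact b)"
    using binomial_fact_lemma[of a m] by (simp add: m_def c_def algebra_simps)
  have "2 * (Suc m choose Suc a) \<le> Suc a * (Suc m choose Suc a)"
    using ab by (intro mult_right_mono) auto
  also have "\<dots> = Suc m * c" unfolding c_def by (rule Suc_times_binomial)
  finally have "(m - 1) * (2 * (Suc m choose Suc a)) \<le> (m - 1) * (Suc m * c)" by simp
  also have "\<dots> \<le> m ^ 2 * c"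
    by (cases m) (auto simp: power2_eq_square algebra_simps)
  also have "\<dots> \<le> c ^ 2 * c" using m by (intro mult_right_mono power_mono) auto
  also have "\<dots> = c ^ 3" by (simp add: eval_nat_numeral)
  also have "\<dots> \<le> c ^ D" using D c0 by (intro power_increasing) auto
  finally have "(m - 1) * (2 * (Suc m choose Suc a)) * (fact a * fact b) ^ D
      \<le> c ^ D * (fact a * fact b) ^ D"
    by (rule mult_right_mono) simp
  then show ?thesis
    by (simp add: fact_m power_mult_distrib mult.assoc flip: m_def)
qed

lemma twice_sum_splits_le:
  fixes n D :: nat
  assumes D: "3 \<le> D"
  shows "2 * (\<Sum>k\<in>{2..<n}. (n choose k) * (fact (k - 1) * fact (n - k)) ^ D)
    \<le> (fact (n - 1) :: nat) ^ D"
proof (cases "3 \<le> n")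
  case True
  let ?t = "\<lambda>k. (n choose k) * (fact (k - 1) * fact (n - k)) ^ D :: nat"
  have "(n - 2) * (2 * ?t k) \<le> fact (n - 1) ^ D" if "k \<in> {2..<n}" for k
    using twice_split_term_le[of "k - 1" "n - k" D] that D by (simp add: numeral_2_eq_2)
  then have "(\<Sum>k\<in>{2..<n}. (n - 2) * (2 * ?t k)) \<le> (\<Sum>k\<in>{2..<n}. fact (n - 1) ^ D)"
    by (rule sum_mono)
  then have "(n - 2) * (2 * (\<Sum>k\<in>{2..<n}. ?t k)) \<le> (n - 2) * fact (n - 1) ^ D"
    by (simp add: sum_distrib_left)
  then show ?thesis using True by simp
qed simp

text \<open>
  Induction on \<open>n\<close>.  The exponents satisfy \<open>(k - 1) + (n - k) = n - 1\<close>, so the powers of \<open>C\<close> pass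
  through the recurrence unchanged; \<open>C\<close> is therefore free to be chosen large enough for the
  hypothesis on \<open>p\<close>.  The splits use up at most one half of the bound and \<open>p\<close> the other half.
\<close>

lemma recurrence_bound:
  fixes f p :: "nat \<Rightarrow> nat" and D C :: nat
  assumes D: "3 \<le> D"
    and base: "\<And>n. n \<le> 1 \<Longrightarrow> f n \<le> 1"
    and p: "\<And>n. 2 \<le> n \<Longrightarrow> 2 * p n \<le> fact (n - 1) ^ D * C ^ (n - 1)"
    and rec: "\<And>n. f n \<le> p n + (\<Sum>k\<in>{2..<n}. (n choose k) * (f k * f (n - k + 1)))"
  shows "f n \<le> fact (n - 1) ^ D * C ^ (n - 1)"
proof (induction n rule: less_induct)
  case (less n)
  show ?case
  proof (cases "2 \<le> n")
    case False
    then have "n = 0 \<or> n = 1" by linarith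
    then show ?thesis using base[of n] by auto
  next
    case True
    have step: "(n choose k) * (f k * f (n - k + 1)) \<le>
        (n choose k) * (fact (k - 1) * fact (n - k)) ^ D * C ^ (n - 1)" if k: "k \<in> {2..<n}" for k
    proof -
      have "f k * f (n - k + 1) \<le>
          (fact (k - 1) ^ D * C ^ (k - 1)) * (fact (n - k) ^ D * C ^ (n - k))"
        using less.IH[of k] less.IH[of "n - k + 1"] k by (intro mult_le_mono) auto
      also have "\<dots> = (fact (k - 1) * fact (n - k)) ^ D * (C ^ (k - 1) * C ^ (n - k))"
        by (simp add: power_mult_distrib mult_ac)
      also have "C ^ (k - 1) * C ^ (n - k) = C ^ (n - 1)" using k by (simp flip: power_add)
      finally show ?thesis by (simp add: mult.assoc)
    qed
    have "(\<Sum>k\<in>{2..<n}. (n choose k) * (f k * f (n - k + 1))) \<le>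
        (\<Sum>k\<in>{2..<n}. (n choose k) * (fact (k - 1) * fact (n - k)) ^ D) * C ^ (n - 1)"
      unfolding sum_distrib_right by (rule sum_mono) (rule step)
    then have "2 * (\<Sum>k\<in>{2..<n}. (n choose k) * (f k * f (n - k + 1))) \<le>
        2 * (\<Sum>k\<in>{2..<n}. (n choose k) * (fact (k - 1) * fact (n - k)) ^ D) * C ^ (n - 1)"
      by simp
    also have "\<dots> \<le> fact (n - 1) ^ D * C ^ (n - 1)"
      by (rule mult_right_mono[OF twice_sum_splits_le[OF D]]) simp
    finally show ?thesis using p[OF True] rec[of n] by linarith
  qed
qed

section \<open>Conversion between exponents of order n log n and powers of factorials\<close>

text \<open>
  The single term \<open>n ^ n / fact n\<close> of the exponential series is at most \<open>exp n \<le> 3 ^ n\<close>.  Passing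
  from \<open>n\<close> to \<open>m = n - 1\<close> costs \<open>3 \<le> 3 ^ m\<close> and \<open>n \<le> 2 ^ m\<close>, hence the base \<open>3 * 3 * 2 = 18\<close>.
\<close>

lemma self_power_le_fact:
  assumes "2 \<le> n"
  shows "n ^ n \<le> 18 ^ (n - 1) * (fact (n - 1) :: nat)"
proof -
  obtain m where n: "n = Suc m" and m: "1 \<le> m" using assms by (cases n) auto
  have "real n ^ n / fact n \<le> exp (real n)"
  proof -
    have "(\<Sum>k\<in>{n}. real n ^ k /\<^sub>R fact k) \<le> (\<Sum>k. real n ^ k /\<^sub>R fact k)"
      by (rule sum_le_suminf) (auto intro: summable_exp)
    then show ?thesis by (simp add: exp_def divide_inverse mult.commute)
  qed
  also have "\<dots> = exp 1 ^ n" by (simp flip: exp_of_nat_mult)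
  also have "\<dots> \<le> 3 ^ n" by (intro power_mono exp_le) auto
  finally have "real n ^ n \<le> 3 ^ n * fact n" by (simp add: field_simps)
  also have "\<dots> = real (3 ^ n * fact n)" by simp
  finally have "n ^ n \<le> 3 ^ n * fact n"
    by (metis of_nat_le_iff of_nat_power)
  also have "\<dots> = 3 * 3 ^ m * (n * fact m)" by (simp add: n)
  also have "\<dots> \<le> 3 ^ m * 3 ^ m * (2 ^ m * fact m)"
  proof (intro mult_le_mono le_refl)
    show "(3::nat) \<le> 3 ^ m" using m by (intro self_le_power) auto
    show "n \<le> 2 ^ m" using less_exp[of m] by (simp add: n Suc_le_eq)
  qed
  also have "\<dots> = 18 ^ m * fact m"
    by (simp flip: power_mult_distrib mult.assoc)
  finally show ?thesis by (simp add: n)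
qed

text \<open>
  Since \<open>2 powr (d * n * log 2 n) = (n ^ n) ^ d\<close>, only the finitely many \<open>n\<close> at which the
  asymptotic bound may fail need a separate constant.
\<close>

lemma two_pow_nlogn_imp_power:
  assumes "two_pow_bigo p (\<lambda>n. real n * log 2 (real n))"
  obtains d K :: nat where "\<And>n. 2 \<le> n \<Longrightarrow> p n \<le> K * (n ^ n) ^ d"
proof -
  obtain f where f: "f \<in> O(\<lambda>n. real n * log 2 (real n))" and pf: "\<And>n. real (p n) \<le> 2 powr f n"
    using assms unfolding two_pow_bigo_def by blast
  obtain c where c: "eventually (\<lambda>n. norm (f n) \<le> c * norm (real n * log 2 (real n))) at_top"
    using f by (auto elim!: landau_o.bigE)
  then obtain N where N: "\<And>n. n \<ge> N \<Longrightarrow> \<bar>f n\<bar> \<le> c * \<bar>real n * log 2 (real n)\<bar>"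
    by (auto simp: eventually_at_top_linorder)
  define d where "d = nat \<lceil>c\<rceil>"
  have cd: "c \<le> real d" by (simp add: d_def real_nat_ceiling_ge)
  \<comment> \<open>The sum covers the exceptional \<open>n < N\<close>; the summand 1 keeps the bound valid for all other \<open>n\<close>.\<close>
  define K where "K = 1 + (\<Sum>n<N. p n)"
  show ?thesis
  proof (rule that[of K d])
    fix n :: nat assume n: "2 \<le> n"
    have pos: "1 \<le> (n ^ n) ^ d" using n by simp
    show "p n \<le> K * (n ^ n) ^ d"
    proof (cases "n < N")
      case True
      then have "p n \<le> (\<Sum>n<N. p n)" by (intro member_le_sum) auto
      then have "p n \<le> K" by (simp add: K_def)
      also have "\<dots> \<le> K * (n ^ n) ^ d" using pos by simp
      finally show ?thesis .
    next
      case False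
      have l: "0 \<le> real n * log 2 (real n)" using n by simp
      have "f n \<le> c * (real n * log 2 (real n))" using N[of n] False l by simp
      also have "\<dots> \<le> real d * (real n * log 2 (real n))" by (rule mult_right_mono[OF cd l])
      also have "\<dots> = log 2 (real ((n ^ n) ^ d))" using n by (simp add: log_nat_power)
      finally have "2 powr f n \<le> 2 powr log 2 (real ((n ^ n) ^ d))" by simp
      also have "\<dots> = real ((n ^ n) ^ d)" using n by (intro powr_log_cancel) auto
      finally have "p n \<le> (n ^ n) ^ d" using pf[of n] by (meson of_nat_le_iff order_trans)
      also have "\<dots> \<le> K * (n ^ n) ^ d" by (simp add: K_def)
      finally show ?thesis .
    qed
  qed
qed

text \<open>
  The exponent is the logarithm of the majorant itself, so that the pointwise bound holds for
  every \<open>n\<close>; it is of order \<open>n log n\<close> by \<open>fact (n - 1) \<le> n ^ n\<close>, where \<open>log 2 n \<ge> 1\<close>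
  for \<open>n \<ge> 2\<close> lets the linear contribution of \<open>C\<close> be absorbed.
\<close>

lemma two_pow_nlogn_if_fact_power:
  fixes C D :: nat
  assumes le: "\<And>n. a n \<le> fact (n - 1) ^ D * C ^ (n - 1)" and C: "1 \<le> C"
  shows "two_pow_bigo a (\<lambda>n. real n * log 2 (real n))"
proof -
  define F :: "nat \<Rightarrow> nat" where "F = (\<lambda>n. fact (n - 1) ^ D * C ^ (n - 1))"
  have F1: "1 \<le> F n" for n using C by (simp add: F_def Suc_le_eq)
  have bound: "norm (log 2 (real (F n))) \<le> (real D + log 2 (real C)) * norm (real n * log 2 (real n))"
    if n: "2 \<le> n" for n
  proof -
    have "F n \<le> (n ^ n) ^ D * C ^ n"
      unfolding F_def
    proof (intro mult_le_mono power_mono power_increasing)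
      have "(fact (n - 1) :: nat) \<le> fact n" by (intro fact_mono) auto
      also have "\<dots> \<le> n ^ n" using fact_le_power[of n, where 'a = nat] by simp
      finally show "(fact (n - 1) :: nat) \<le> n ^ n" .
    qed (use C in auto)
    then have "log 2 (real (F n)) \<le> log 2 (real ((n ^ n) ^ D * C ^ n))"
      using F1[of n] C n by (subst log_le_cancel_iff) (auto simp: Suc_le_eq simp del: of_nat_mult of_nat_power)
    also have "\<dots> = real D * (real n * log 2 (real n)) + real n * log 2 (real C)"
      using C n by (simp add: log_mult log_nat_power)
    also have "real n * log 2 (real C) \<le> log 2 (real C) * (real n * log 2 (real n))"
    proof -
      have "1 \<le> log 2 (real n)" "0 \<le> log 2 (real C)" using n C by (auto simp: le_log_iff)
      then have "log 2 (real C) * real n * 1 \<le> log 2 (real C) * real n * log 2 (real n)"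
        by (intro mult_left_mono) auto
      then show ?thesis by (simp add: mult_ac)
    qed
    finally show ?thesis using F1[of n] n by (simp add: algebra_simps)
  qed
  have "(\<lambda>n. log 2 (real (F n))) \<in> O(\<lambda>n. real n * log 2 (real n))"
  proof (rule landau_o.bigI)
    have "0 \<le> log 2 (real C)" using C by simp
    then show "0 < real D + log 2 (real C) + 1" by linarith
    have "norm (log 2 (real (F n))) \<le>
        (real D + log 2 (real C) + 1) * norm (real n * log 2 (real n))" if "2 \<le> n" for n
      using bound[OF that] by (rule order_trans) (intro mult_right_mono, auto)
    then show "eventually (\<lambda>n. norm (log 2 (real (F n))) \<le>
        (real D + log 2 (real C) + 1) * norm (real n * log 2 (real n))) at_top"
      unfolding eventually_at_top_linorder by blast
  qed
  moreover have "real (a n) \<le> 2 powr log 2 (real (F n))" for n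
  proof -
    have "a n \<le> F n" using le by (simp add: F_def)
    moreover have "2 powr log 2 (real (F n)) = real (F n)"
      using F1[of n] by (intro powr_log_cancel) auto
    ultimately show ?thesis by simp
  qed
  ultimately show ?thesis
    unfolding two_pow_bigo_def by (intro bexI[of _ "\<lambda>n. log 2 (real (F n))"] allI)
qed

section \<open>Counting the graphs of a hereditary class\<close>

lemma card_labelled_graphs_le_1:
  assumes X: "hereditary X" and n: "n \<le> 1"
  shows "card (labelled_graphs X n) \<le> 1"
proof -
  have "labelled_graphs X n \<subseteq> {\<lparr> pverts = {1..n}, parcs = {} \<rparr>}"
  proof
    fix G assume "G \<in> labelled_graphs X n"
    then have G: "pair_graph G" "pverts G = {1..n}"
      using hereditary_pair_graph[OF X] by (auto simp: labelled_graphs_def)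
    interpret pair_graph G by (rule G(1))
    have "parcs G = {}"
      using parcs_subset_pverts[OF G(1)] G(2) n pair_no_loops by fastforce
    then show "G \<in> {\<lparr> pverts = {1..n}, parcs = {} \<rparr>}" using G(2) by simp
  qed
  from card_mono[OF _ this] show ?thesis by simp
qed

theorem theorem1:
  fixes X :: "nat pair_pre_digraph set"
  assumes "hereditary X"
    and "two_pow_bigo (\<lambda>n. card {G \<in> labelled_graphs X n. prime_graph G})
           (\<lambda>n. real n * log 2 (real n))"
  shows "two_pow_bigo (\<lambda>n. card (labelled_graphs X n)) (\<lambda>n. real n * log 2 (real n))"
proof -
  let ?p = "\<lambda>n. card {G \<in> labelled_graphs X n. prime_graph G}"
  obtain d K :: nat where dK: "\<And>n. 2 \<le> n \<Longrightarrow> ?p n \<le> K * (n ^ n) ^ d"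
    by (rule two_pow_nlogn_imp_power[OF assms(2)]) (rule that)
  \<comment> \<open>The exponent \<open>d\<close> pays for the prime graphs, the extra 3 for the splits; \<open>L\<close> contains the factor
    two by which \<open>recurrence_bound\<close> wants the prime graphs to stay below the majorant.\<close>
  define D where "D = d + 3"
  define L where "L = 2 * (K + 1)"
  define C where "C = L * 18 ^ d"
  have L: "1 \<le> L" by (simp add: L_def)
  then have C: "1 \<le> C" by (simp add: C_def Suc_le_eq)
  have p: "2 * ?p n \<le> fact (n - 1) ^ D * C ^ (n - 1)" if n: "2 \<le> n" for n
  proof -
    have "2 * ?p n \<le> 2 * (K * (n ^ n) ^ d)" using dK[OF n] by simp
    also have "\<dots> \<le> L * (n ^ n) ^ d" by (simp add: L_def)
    also have "\<dots> \<le> L ^ (n - 1) * (18 ^ (n - 1) * fact (n - 1)) ^ d"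
    proof (intro mult_le_mono power_mono self_power_le_fact[OF n])
      show "L \<le> L ^ (n - 1)" using n L by (intro self_le_power) auto
    qed simp
    also have "(18 ^ (n - 1) * fact (n - 1) :: nat) ^ d = (18 ^ d) ^ (n - 1) * fact (n - 1) ^ d"
      by (simp add: power_mult_distrib mult.commute flip: power_mult)
    also have "L ^ (n - 1) * ((18 ^ d) ^ (n - 1) * fact (n - 1) ^ d) = fact (n - 1) ^ d * C ^ (n - 1)"
      by (simp add: C_def power_mult_distrib)
    also have "\<dots> \<le> fact (n - 1) ^ D * C ^ (n - 1)"
      by (intro mult_right_mono power_increasing) (auto simp: D_def Suc_le_eq)
    finally show ?thesis .
  qed
  have "card (labelled_graphs X n) \<le> fact (n - 1) ^ D * C ^ (n - 1)" for n
  proof (rule recurrence_bound[where f = "\<lambda>n. card (labelled_graphs X n)" and p = ?p])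
    show "3 \<le> D" by (simp add: D_def)
    show "card (labelled_graphs X n) \<le> 1" if "n \<le> 1" for n
      using card_labelled_graphs_le_1[OF assms(1) that] .
    show "2 * ?p n \<le> fact (n - 1) ^ D * C ^ (n - 1)" if "2 \<le> n" for n
      using p[OF that] .
    show "card (labelled_graphs X n) \<le> ?p n + (\<Sum>k\<in>{2..<n}. (n choose k) *
        (card (labelled_graphs X k) * card (labelled_graphs X (n - k + 1))))" for n
      using card_labelled_graphs_le_prime_plus_splits[OF assms(1)] .
  qed
  then show ?thesis using C by (rule two_pow_nlogn_if_fact_power)
qed

end
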